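(* Consider the linear intensity model $d\lambda(t)=A(\lambda(t)-\lambda_0)\,dt+B\,dU(t)$ described in the context, and for $\lambda\ge\lambda_0$ let $M(\lambda)=A+BJ(\lambda)$, where $J(\lambda)$ is the $d\times d$ diagonal matrix with entries $\int x\,\nu_k(\lambda,dx)$, $k=1,\dots,d$, on the diagonal. Suppose that $M(\lambda)$ is diagonalisable, that the moments $\int x\,\nu_k(\lambda,dx)$ and $\int x^2\,\nu_k(\lambda,dx)$, $k=1,\dots,d$, are bounded as functions of $\lambda$, that all eigenvalues of $M(\lambda)+M(\lambda)^\top$ are negative, and that $\sup_{\lambda\ge\lambda_0}\gamma(\lambda)<0$, where $\gamma(\lambda)$ denotes the largest (negative) eigenvalue of $M(\lambda)+M(\lambda)^\top$. Then $\lambda(t)$ is stable with $f(\lambda)=\lambda^\top\lambda$, in the sense that there exist constants $C_1>0$ and $C_0\in\mathbb{R}$ such that $$\mathcal{A}f(\lambda)\le C_0-C_1f(\lambda)\qquad\text{for all }\lambda\ge\lambda_0,$$ where $\mathcal{A}$ is the extended generator of $\lambda(t)$.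
   Context: Fix $d\ge1$. A $d$-dimensional point process $\{(T_n,X_n)\}_{n\ge1}$ consists of non-decreasing random times $T_n$ ($T_0=0$) and marks $X_n\in\{1,\dots,d\}$; $N_k(t)=\sum_{n\ge1}1_{\{X_n=k,\,T_n\le t\}}$. Each $N_k$ admits an optional intensity $\lambda_k(t)\ge0$ with respect to a filtration to which it is adapted, i.e. $\mathbb{E}[\int_0^\infty g(s)\,dN_k(s)]=\mathbb{E}[\int_0^\infty g(s)\lambda_k(s)\,ds]$ for predictable $g$. Put $U_k(t)=\sum_{n\ge1}Y^k_n1_{\{X_n=k,\,T_n\le t\}}$, $U=(U_1,\dots,U_d)^\top$, where the jump sizes $Y_n^k\ge0$ follow the distribution $\nu_k(\lambda(T_n-),\cdot)$, with $\{\nu_k(\lambda,\cdot)\}$ a given family of probability distributions. The intensity $\lambda(t)=(\lambda_1(t),\dots,\lambda_d(t))^\top$ follows the linear model $d\lambda(t)=A(\lambda(t)-\lambda_0)dt+B\,dU(t)$ with $A,B\in\mathbb{R}^{d\times d}$ and $\lambda_0=(\lambda_0^1,\dots,\lambda_0^d)^\top\ge0$ (inequalities between vectors are componentwise). Write $b_k=Be_k$ for the $k$th column of $B$. The extended generator of $\lambda(t)$ is $$(\mathcal{A}f)(\lambda)=(\nabla f(\lambda))^\top A(\lambda-\lambda_0)+\sum_{k=1}^d\lambda_k\int\big(f(\lambda+b_kx)-f(\lambda)\big)\nu_k(\lambda,dx).$$ *)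

theory Defs
  imports "HOL-Analysis.Analysis" "HOL-Probability.Probability"
begin

definition eigenvalue :: "'a::field ^ 'n ^ 'n \<Rightarrow> 'a \<Rightarrow> bool" where
  "eigenvalue M c \<longleftrightarrow> (\<exists>v. v \<noteq> 0 \<and> M *v v = c *s v)"

text \<open>Intended for real symmetric matrices, whose set of eigenvalues is finite and nonempty.\<close>

definition largest_eigenvalue :: "real ^ 'n ^ 'n \<Rightarrow> real" where
  "largest_eigenvalue S = Max {c. eigenvalue S c}"

text \<open>Real matrices are diagonalised over the complex numbers. This is implied by
  diagonalisability over the reals, hence the weaker hypothesis.\<close>

definition diagonalisable :: "real ^ 'n ^ 'n \<Rightarrow> bool" where
  "diagonalisable M \<longleftrightarrow>
     (\<exists>P D :: complex ^ 'n ^ 'n. invertible P \<and> (\<forall>i j. i \<noteq> j \<longrightarrow> D $ i $ j = 0) \<and>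
        (\<chi> i j. complex_of_real (M $ i $ j)) = P ** D ** matrix_inv P)"

definition gradient :: "('a::real_inner \<Rightarrow> real) \<Rightarrow> 'a \<Rightarrow> 'a" where
  "gradient f x = (THE D. GDERIV f x :> D)"

lemma gradient_eqI:
  assumes "GDERIV f x :> D"
  shows "gradient f x = D"
  unfolding gradient_def
proof (rule the_equality)
  fix E assume "GDERIV f x :> E"
  then have "(\<lambda>h. inner h E) = (\<lambda>h. inner h D)"
    using assms unfolding gderiv_def by (rule has_derivative_unique)
  then have "inner (E - D) E = inner (E - D) D"
    by (rule fun_cong)
  then have "inner (E - D) (E - D) = 0"
    by (simp add: inner_diff_right)
  then show "E = D" by simp
qed (rule assms)

text \<open>The jump sizes of component \<open>k\<close> in state \<open>l\<close> have law \<open>\<nu> k l\<close>.\<close>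

definition jump_size_law :: "real measure \<Rightarrow> bool" where
  "jump_size_law N \<longleftrightarrow> prob_space N \<and> sets N = sets borel \<and> (AE x in N. 0 \<le> x)"

definition mean_jump_matrix ::
  "('d \<Rightarrow> real ^ 'd \<Rightarrow> real measure) \<Rightarrow> real ^ 'd \<Rightarrow> real ^ 'd ^ 'd" where
  "mean_jump_matrix \<nu> l = (\<chi> i j. if i = j then (\<integral>x. x \<partial>\<nu> i l) else 0)"

definition drift_matrix ::
  "real ^ 'd ^ 'd \<Rightarrow> real ^ 'd ^ 'd \<Rightarrow> ('d \<Rightarrow> real ^ 'd \<Rightarrow> real measure) \<Rightarrow>
    real ^ 'd \<Rightarrow> real ^ 'd ^ 'd" where
  "drift_matrix A B \<nu> l = A + B ** mean_jump_matrix \<nu> l"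

text \<open>Extended generator of the intensity \<open>\<lambda>(t)\<close> with dynamics
  \<open>d\<lambda>(t) = A (\<lambda>(t) - \<lambda>\<^sub>0) dt + B dU(t)\<close>, where \<open>U\<^sub>k\<close> jumps at rate \<open>\<lambda>\<^sub>k(t)\<close>
  with jump sizes of law \<open>\<nu> k (\<lambda>(t-))\<close>.\<close>

definition extended_generator ::
  "real ^ 'd ^ 'd \<Rightarrow> real ^ 'd ^ 'd \<Rightarrow> real ^ 'd \<Rightarrow> ('d \<Rightarrow> real ^ 'd \<Rightarrow> real measure) \<Rightarrow>
    (real ^ 'd \<Rightarrow> real) \<Rightarrow> real ^ 'd \<Rightarrow> real" where
  "extended_generator A B l0 \<nu> f l =
     inner (gradient f l) (A *v (l - l0)) +
     (\<Sum>k\<in>UNIV. l $ k * (\<integral>x. (f (l + x *\<^sub>R column k B) - f l) \<partial>\<nu> k l))"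

text \<open>The Bochner integral of a non-integrable function is 0, so finiteness of the
  moments has to be required through integrability.\<close>

definition bounded_moment ::
  "nat \<Rightarrow> (real ^ 'd \<Rightarrow> real measure) \<Rightarrow> (real ^ 'd) set \<Rightarrow> bool" where
  "bounded_moment p N S \<longleftrightarrow>
     (\<forall>l\<in>S. integrable (N l) (\<lambda>x. x ^ p)) \<and> bounded ((\<lambda>l. \<integral>x. x ^ p \<partial>N l) ` S)"

end

theory Submission
  imports Defs
begin

text \<open>
  For \<open>f(\<lambda>) = \<lambda>\<^sup>T \<lambda>\<close> the generator can be computed exactly. Since \<open>\<nabla>f(\<lambda>) = 2\<lambda>\<close> and
  \<open>f(\<lambda> + x b\<^sub>k) - f(\<lambda>) = 2 x \<lambda>\<^sup>T b\<^sub>k + x\<^sup>2 \<bar>b\<^sub>k\<bar>\<^sup>2\<close>, the drift and the mean effect of the jumps combine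
  to \<open>2 \<lambda>\<^sup>T M(\<lambda>) \<lambda> = \<lambda>\<^sup>T (M(\<lambda>) + M(\<lambda>)\<^sup>T) \<lambda>\<close>, and what remains is of first order:
  \<open>-2 \<lambda>\<^sup>T A \<lambda>\<^sub>0\<close> and the second moments weighted by \<open>\<lambda>\<^sub>k \<bar>b\<^sub>k\<bar>\<^sup>2\<close>
  (lemma \<open>extended_generator_square\<close>).

  By the Rayleigh principle (lemma \<open>quadratic_form_le_largest_eigenvalue\<close>) the quadratic part is
  at most \<open>\<gamma> \<bar>\<lambda>\<bar>\<^sup>2\<close> with \<open>\<gamma> = sup \<gamma>(\<lambda>) < 0\<close>, while bounded second moments make the remainder
  at most \<open>K \<bar>\<lambda>\<bar>\<close>. Half of the negative quadratic term absorbs the linear one, by completing the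
  square.
\<close>

section \<open>Largest eigenvalues of symmetric matrices\<close>

lemma inner_matrix_vector_mult_symmetric:
  fixes S :: "real ^ 'n ^ 'n"
  assumes "transpose S = S"
  shows "inner x (S *v y) = inner (S *v x) y"
  using assms by (metis dot_lmul_matrix transpose_matrix_vector)

text \<open>Eigenvectors of a symmetric matrix for distinct eigenvalues are orthogonal, so that picking
  one eigenvector per eigenvalue gives a linearly independent family, which is finite.\<close>

lemma finite_eigenvalues_symmetric:
  fixes S :: "real ^ 'n ^ 'n"
  assumes sym: "transpose S = S"
  shows "finite {c. eigenvalue S c}"
proof -
  let ?E = "{c. eigenvalue S c}"
  have "\<forall>c\<in>?E. \<exists>v. v \<noteq> 0 \<and> S *v v = c *s v"
    by (simp add: eigenvalue_def)
  then obtain v where v: "\<And>c. c \<in> ?E \<Longrightarrow> v c \<noteq> 0 \<and> S *v v c = c *s v c"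
    using bchoice[of ?E "\<lambda>c v. v \<noteq> 0 \<and> S *v v = c *s v"] by blast
  have orth: "inner (v c) (v d) = 0" if "c \<in> ?E" "d \<in> ?E" "c \<noteq> d" for c d
  proof -
    have "inner (v c) (d *s v d) = inner (c *s v c) (v d)"
      using inner_matrix_vector_mult_symmetric[OF sym, of "v c" "v d"] v that by simp
    then show ?thesis
      using that by (simp add: scalar_mult_eq_scaleR)
  qed
  have inj: "inj_on v ?E"
  proof (rule inj_onI)
    fix c d assume "c \<in> ?E" "d \<in> ?E" "v c = v d"
    then show "c = d"
      using orth[of c d] v[of c] by auto
  qed
  have "pairwise orthogonal (v ` ?E)"
    unfolding pairwise_def orthogonal_def using orth by blast
  moreover have "0 \<notin> v ` ?E"
    using v by fastforce
  ultimately have "finite (v ` ?E)"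
    using pairwise_orthogonal_independent independent_imp_finite by blast
  then show ?thesis
    using inj by (rule finite_imageD)
qed

text \<open>The maximum \<open>c\<close> of the quadratic form on the unit sphere is attained by compactness, at \<open>v\<close> say.
  Then \<open>c \<bar>w\<bar>\<^sup>2 - w\<^sup>T S w\<close> is nonnegative and vanishes at \<open>v\<close>, so that its gradient \<open>2(c v - S v)\<close>
  vanishes there and \<open>v\<close> is an eigenvector for \<open>c\<close>.\<close>

lemma ex_eigenvalue_dominating_quadratic_form:
  fixes S :: "real ^ 'n ^ 'n"
  assumes sym: "transpose S = S"
  shows "\<exists>c. eigenvalue S c \<and> (\<forall>w. inner w (S *v w) \<le> c * inner w w)"
proof -
  have "continuous_on (sphere 0 1) (\<lambda>w. inner w (S *v w))"
    by (intro continuous_intros linear_continuous_on matrix_vector_mul_bounded_linear)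
  moreover have "(axis undefined 1 :: real ^ 'n) \<in> sphere 0 1"
    by (simp add: norm_axis_1)
  ultimately obtain v where v: "norm v = 1"
    and vmax: "\<And>w. norm w = 1 \<Longrightarrow> inner w (S *v w) \<le> inner v (S *v v)"
    using continuous_attains_sup[of "sphere 0 1" "\<lambda>w. inner w (S *v w)"]
    by auto
  define c where "c = inner v (S *v v)"
  define q where "q w = c * inner w w - inner w (S *v w)" for w
  have q_nonneg: "q w \<ge> 0" for w
  proof (cases "w = 0")
    case False
    let ?u = "(1 / norm w) *\<^sub>R w"
    have "inner ?u (S *v ?u) \<le> c"
      unfolding c_def by (rule vmax) (use False in simp)
    then have "inner w (S *v w) / (norm w * norm w) \<le> c"
      by (simp add: matrix_vector_mult_scaleR)
    then show ?thesis
      using False by (simp add: q_def dot_square_norm power2_eq_square field_simps)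
  qed (simp add: q_def)
  define u where "u = c *s v - S *v v"
  have expand: "q (v - t *\<^sub>R u) = t\<^sup>2 * q u - 2 * t * inner u u" for t
  proof -
    have uu: "inner u u = c * inner v u - inner u (S *v v)"
      by (subst u_def)
        (simp add: inner_diff_left scalar_mult_eq_scaleR inner_commute[of "S *v v" u])
    have vu: "inner v (S *v u) = inner u (S *v v)"
      using inner_matrix_vector_mult_symmetric[OF sym, of v u] by (simp add: inner_commute)
    have vv: "inner v v = 1"
      using v by (simp add: dot_square_norm)
    show ?thesis
      unfolding q_def
      by (simp add: matrix_vector_mult_diff_distrib matrix_vector_mult_scaleR inner_diff_left
          inner_diff_right vu uu vv c_def[symmetric] inner_commute[of u v] algebra_simps
          power2_eq_square)
  qed
  have "u = 0"
  proof (rule ccontr)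
    assume "u \<noteq> 0"
    then have pos: "inner u u > 0" by simp
    \<comment> \<open>A step size for which the first-order decrease along \<open>u\<close> outweighs the second-order term.\<close>
    define t where "t = inner u u / (q u + 1)"
    have t: "t > 0" "t * q u \<le> inner u u"
      using pos q_nonneg[of u] by (auto simp: t_def field_simps)
    have "t * (2 * inner u u) \<le> t * (t * q u)"
      using q_nonneg[of "v - t *\<^sub>R u"] expand[of t] by (simp add: power2_eq_square)
    then show False
      using t pos by auto
  qed
  then have "eigenvalue S c"
    using v unfolding eigenvalue_def u_def by (intro exI[of _ v]) auto
  then show ?thesis
    using q_nonneg by (auto simp: q_def)
qed

lemma eigenvalue_largest_eigenvalue:
  fixes S :: "real ^ 'n ^ 'n"
  assumes "transpose S = S"
  shows "eigenvalue S (largest_eigenvalue S)"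
proof -
  have "{c. eigenvalue S c} \<noteq> {}"
    using ex_eigenvalue_dominating_quadratic_form[OF assms] by auto
  from Max_in[OF finite_eigenvalues_symmetric[OF assms] this] show ?thesis
    by (simp add: largest_eigenvalue_def)
qed

lemma quadratic_form_le_largest_eigenvalue:
  fixes S :: "real ^ 'n ^ 'n"
  assumes "transpose S = S"
  shows "inner w (S *v w) \<le> largest_eigenvalue S * inner w w"
proof -
  obtain c where c: "eigenvalue S c" "\<And>w. inner w (S *v w) \<le> c * inner w w"
    using ex_eigenvalue_dominating_quadratic_form[OF assms] by blast
  have "c \<le> largest_eigenvalue S"
    unfolding largest_eigenvalue_def
    by (rule Max_ge) (use c finite_eigenvalues_symmetric[OF assms] in auto)
  then have "c * inner w w \<le> largest_eigenvalue S * inner w w"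
    by (rule mult_right_mono) simp
  then show ?thesis
    using c(2)[of w] by simp
qed

lemma quadratic_form_symmetrised:
  fixes M :: "real ^ 'n ^ 'n"
  shows "inner w ((M + transpose M) *v w) = 2 * inner w (M *v w)"
proof -
  have "inner w (transpose M *v w) = inner w (M *v w)"
    by (metis dot_lmul_matrix inner_commute transpose_matrix_vector transpose_transpose)
  then show ?thesis
    by (simp add: matrix_vector_mult_add_rdistrib inner_add_right)
qed

section \<open>The generator applied to the squared norm\<close>

lemma gradient_square: "gradient (\<lambda>x :: 'a::real_inner. inner x x) l = 2 *\<^sub>R l"
proof (rule gradient_eqI)
  show "GDERIV (\<lambda>x. inner x x) l :> 2 *\<^sub>R l"
    unfolding gderiv_def
    by (auto intro!: derivative_eq_intros simp: inner_commute)
qed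

lemma matrix_vector_mult_eq_sum_columns:
  fixes B :: "real ^ 'n ^ 'm"
  shows "B *v w = (\<Sum>k\<in>UNIV. w $ k *\<^sub>R column k B)"
  by (simp add: matrix_mult_sum scalar_mult_eq_scaleR)

lemma mean_jump_matrix_mult_vector:
  "mean_jump_matrix \<nu> l *v w = (\<chi> k. (\<integral>x. x \<partial>\<nu> k l) * w $ k)"
  by (simp add: vec_eq_iff mean_jump_matrix_def matrix_vector_mult_def if_distrib if_distribR
      sum.delta cong: if_cong)

lemma inner_drift_matrix:
  "inner l (drift_matrix A B \<nu> l *v l) =
    inner l (A *v l) + (\<Sum>k\<in>UNIV. l $ k * ((\<integral>x. x \<partial>\<nu> k l) * inner l (column k B)))"
proof -
  have "B ** mean_jump_matrix \<nu> l *v l = B *v (\<chi> k. (\<integral>x. x \<partial>\<nu> k l) * l $ k)"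
    by (simp only: matrix_vector_mul_assoc[symmetric] mean_jump_matrix_mult_vector)
  then show ?thesis
    by (simp add: drift_matrix_def matrix_vector_mult_add_rdistrib inner_add_right
        matrix_vector_mult_eq_sum_columns[of B] inner_sum_right mult_ac)
qed

lemma integral_square_increment:
  fixes l b :: "'a::real_inner"
  assumes "integrable N (\<lambda>x. x)" "integrable N (\<lambda>x. x\<^sup>2)"
  shows "(\<integral>x. (inner (l + x *\<^sub>R b) (l + x *\<^sub>R b) - inner l l) \<partial>N) =
    2 * (\<integral>x. x \<partial>N) * inner l b + (\<integral>x. x\<^sup>2 \<partial>N) * inner b b"
proof -
  have "(\<integral>x. (inner (l + x *\<^sub>R b) (l + x *\<^sub>R b) - inner l l) \<partial>N) =
      (\<integral>x. (x * (2 * inner l b) + x\<^sup>2 * inner b b) \<partial>N)"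
    by (rule Bochner_Integration.integral_cong)
      (simp_all add: inner_add_left inner_add_right inner_commute algebra_simps power2_eq_square)
  also have "\<dots> = (\<integral>x. x * (2 * inner l b) \<partial>N) + (\<integral>x. x\<^sup>2 * inner b b \<partial>N)"
    using assms by (intro Bochner_Integration.integral_add integrable_mult_left) auto
  finally show ?thesis
    by simp
qed

lemma extended_generator_square:
  fixes l :: "real ^ 'd"
  assumes "\<And>k. integrable (\<nu> k l) (\<lambda>x. x)" "\<And>k. integrable (\<nu> k l) (\<lambda>x. x\<^sup>2)"
  shows "extended_generator A B l0 \<nu> (\<lambda>x. inner x x) l =
    inner l ((drift_matrix A B \<nu> l + transpose (drift_matrix A B \<nu> l)) *v l)
    - 2 * inner l (A *v l0)
    + (\<Sum>k\<in>UNIV. l $ k * ((\<integral>x. x\<^sup>2 \<partial>\<nu> k l) * inner (column k B) (column k B)))"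
proof -
  have "l $ k * (\<integral>x. (inner (l + x *\<^sub>R column k B) (l + x *\<^sub>R column k B) - inner l l) \<partial>\<nu> k l) =
      2 * (l $ k * ((\<integral>x. x \<partial>\<nu> k l) * inner l (column k B)))
      + l $ k * ((\<integral>x. x\<^sup>2 \<partial>\<nu> k l) * inner (column k B) (column k B))" for k
    unfolding integral_square_increment[OF assms] by (simp add: algebra_simps)
  then show ?thesis
    unfolding extended_generator_def gradient_square quadratic_form_symmetrised inner_drift_matrix
    by (simp add: matrix_vector_mult_diff_distrib inner_diff_right sum.distrib
        sum_distrib_left[symmetric] distrib_left)
qed

lemma bounded_momentD:
  assumes "bounded_moment p N S"
  shows "\<exists>K. \<forall>l\<in>S. \<bar>\<integral>x. x ^ p \<partial>N l\<bar> \<le> K"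
  using assms by (auto simp: bounded_moment_def bounded_iff)

section \<open>Stability\<close>

text \<open>Completing the square: the linear term is absorbed by half of the quadratic one.\<close>

lemma linear_le_quadratic:
  fixes g K r :: real
  assumes "g > 0"
  shows "K * r \<le> K\<^sup>2 / (2 * g) + g / 2 * r\<^sup>2"
proof -
  have "0 \<le> (g * r - K)\<^sup>2 / (2 * g)"
    using assms by simp
  also have "\<dots> = K\<^sup>2 / (2 * g) + g / 2 * r\<^sup>2 - K * r"
    using assms by (simp add: power2_eq_square field_simps)
  finally show ?thesis by simp
qed

theorem proposition3:
  fixes A B :: "real ^ 'd ^ 'd"
    and l0 :: "real ^ 'd"
    and \<nu> :: "'d \<Rightarrow> real ^ 'd \<Rightarrow> real measure"
  assumes "0 \<le> l0"
    and "\<And>k l. l0 \<le> l \<Longrightarrow> jump_size_law (\<nu> k l)"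
    and "\<And>l. l0 \<le> l \<Longrightarrow> diagonalisable (drift_matrix A B \<nu> l)"
    and "\<And>k. bounded_moment 1 (\<nu> k) {l0..}"
    and "\<And>k. bounded_moment 2 (\<nu> k) {l0..}"
    and "\<And>l c. l0 \<le> l \<Longrightarrow> eigenvalue (drift_matrix A B \<nu> l + transpose (drift_matrix A B \<nu> l)) c \<Longrightarrow> c < 0"
    and "(SUP l\<in>{l0..}. largest_eigenvalue (drift_matrix A B \<nu> l + transpose (drift_matrix A B \<nu> l))) < 0"
  shows "\<exists>C1 C0. C1 > 0 \<and>
    (\<forall>l\<ge>l0. extended_generator A B l0 \<nu> (\<lambda>x. inner x x) l \<le> C0 - C1 * inner l l)"
proof -
  let ?S = "\<lambda>l. drift_matrix A B \<nu> l + transpose (drift_matrix A B \<nu> l)"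
  let ?b = "\<lambda>k. column k B"
  define g where "g = - (SUP l\<in>{l0..}. largest_eigenvalue (?S l))"
  have g: "g > 0"
    using assms(7) unfolding g_def by linarith
  have sym: "transpose (?S l) = ?S l" for l
    by (simp add: transpose_def vec_eq_iff)
  \<comment> \<open>Negativity of every eigenvalue bounds the family of largest eigenvalues, so that its
    supremum really is an upper bound.\<close>
  have "bdd_above ((\<lambda>l. largest_eigenvalue (?S l)) ` {l0..})"
    using assms(6)[OF _ eigenvalue_largest_eigenvalue[OF sym]]
    by (intro bdd_aboveI2[where M = 0]) (simp add: less_imp_le)
  then have le_g: "largest_eigenvalue (?S l) \<le> - g" if "l0 \<le> l" for l
    unfolding g_def using that by (auto intro: cSUP_upper)
  have "\<forall>k. \<exists>K. \<forall>l\<in>{l0..}. \<bar>\<integral>x. x\<^sup>2 \<partial>\<nu> k l\<bar> \<le> K"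
    using bounded_momentD[OF assms(5)] by blast
  then obtain K where K: "\<And>k l. l0 \<le> l \<Longrightarrow> \<bar>\<integral>x. x\<^sup>2 \<partial>\<nu> k l\<bar> \<le> K k"
    unfolding choice_iff by auto
  define L where "L = 2 * norm (A *v l0) + (\<Sum>k\<in>UNIV. K k * inner (?b k) (?b k))"
  have "extended_generator A B l0 \<nu> (\<lambda>x. inner x x) l \<le> L\<^sup>2 / (2 * g) - g / 2 * inner l l"
    if l: "l0 \<le> l" for l
  proof -
    have int: "integrable (\<nu> k l) (\<lambda>x. x)" "integrable (\<nu> k l) (\<lambda>x. x\<^sup>2)" for k
      using assms(4,5)[of k] l by (auto simp: bounded_moment_def)
    have quadratic: "inner l (?S l *v l) \<le> - g * (norm l)\<^sup>2"
    proof -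
      have "inner l (?S l *v l) \<le> largest_eigenvalue (?S l) * inner l l"
        by (rule quadratic_form_le_largest_eigenvalue[OF sym])
      also have "\<dots> \<le> - g * inner l l"
        by (intro mult_right_mono le_g l inner_ge_zero)
      finally show ?thesis
        unfolding dot_square_norm .
    qed
    have drift: "- 2 * inner l (A *v l0) \<le> 2 * norm (A *v l0) * norm l"
      using Cauchy_Schwarz_ineq2[of l "A *v l0"] by (simp only: mult.commute[of "norm l"])
    have "l $ k * ((\<integral>x. x\<^sup>2 \<partial>\<nu> k l) * inner (?b k) (?b k))
        \<le> norm l * (K k * inner (?b k) (?b k))" for k
    proof -
      have "l $ k * ((\<integral>x. x\<^sup>2 \<partial>\<nu> k l) * inner (?b k) (?b k))
          \<le> \<bar>l $ k\<bar> * (\<bar>\<integral>x. x\<^sup>2 \<partial>\<nu> k l\<bar> * inner (?b k) (?b k))"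
        by (rule order_trans[OF abs_ge_self]) (simp add: abs_mult)
      also have "\<dots> \<le> norm l * (K k * inner (?b k) (?b k))"
        using order_trans[OF abs_ge_zero K[OF l]]
        by (intro mult_mono component_le_norm_cart K l mult_nonneg_nonneg) auto
      finally show ?thesis .
    qed
    then have "(\<Sum>k\<in>UNIV. l $ k * ((\<integral>x. x\<^sup>2 \<partial>\<nu> k l) * inner (?b k) (?b k)))
        \<le> (\<Sum>k\<in>UNIV. norm l * (K k * inner (?b k) (?b k)))"
      by (rule sum_mono)
    then have "extended_generator A B l0 \<nu> (\<lambda>x. inner x x) l \<le>
        - g * (norm l)\<^sup>2 + 2 * norm (A *v l0) * norm l
        + (\<Sum>k\<in>UNIV. norm l * (K k * inner (?b k) (?b k)))"
      using quadratic drift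
      unfolding extended_generator_square[where \<nu> = \<nu> and l = l, OF int] by linarith
    also have "\<dots> = - g * (norm l)\<^sup>2 + L * norm l"
      by (simp add: L_def sum_distrib_left algebra_simps)
    also have "\<dots> \<le> L\<^sup>2 / (2 * g) - g / 2 * inner l l"
      using linear_le_quadratic[OF g, of L "norm l"] by (simp add: dot_square_norm)
    finally show ?thesis .
  qed
  moreover have "g / 2 > 0"
    using g by simp
  ultimately show ?thesis
    by blast
qed

end
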